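(* Let $\mu>0$, $L_2>0$, $M_2\ge L_2$. Let $f:\mathbb{E}\to\mathbb{R}$ be $\mu$-strongly star-convex with respect to its minimizer $x^*$ and have $L_2$-Lipschitz-continuous Hessian. Let $x_0\in\mathbb{E}$ with $f(x_0)>f(x^* )$, and let $(x_t)_{t\ge 0}$ be generated by the Cubic Regularized Newton Method with parameter $M_2$ started at $x_0$. Put $f^*=f(x^* )$, $D=\max\{\|x-x^*\| : f(x)\le f(x_0)\}$, $$\alpha^{low}=\min\left\{\tfrac12,\ \sqrt{\tfrac{3\mu}{4(M_2+L_2)D}}\right\},$$ and for $t\ge 0$ $$\kappa_t^{sl}=\frac{(M_2+L_2)\sqrt2}{3\mu^{3/2}}\,(1-\alpha^{low})^{t/2}\,\bigl(f(x_0)-f^*\bigr)^{1/2},\qquad \alpha_t^{sl}=\frac{-1+\sqrt{1+4\kappa_t^{sl}}}{2\kappa_t^{sl}} .$$ Then the method converges globally superlinearly with $\zeta_t=1-\alpha_t^{sl}$; that is, for all $t\ge 0$ $$f(x_{t+1})-f^*\le (1-\alpha_t^{sl})\bigl(f(x_t)-f^*\bigr),$$ where $1>\zeta_t>\zeta_{t+1}$ for all $t\ge0$ and $\zeta_t\to 0$ as $t\to\infty$. Moreover, for every $T\ge 1$, $$f(x_T)-f^*\le \bigl(f(x_0)-f^*\bigr)\prod_{t=0}^{T-1}\bigl(1-\alpha_t^{sl}\bigr).$$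
   Context: $\mathbb{E}$ is a $d$-dimensional real vector space with Euclidean norm $\|x\|=\langle Bx,x\rangle^{1/2}$, where $B:\mathbb{E}\to\mathbb{E}^*$ is a fixed self-adjoint positive-definite operator. $f$ has $L_2$-Lipschitz-continuous Hessian if it is twice continuously differentiable and $\|\nabla^2 f(x)-\nabla^2 f(y)\|_{op}\le L_2\|x-y\|$ for all $x,y\in\mathbb{E}$, with $\|\cdot\|_{op}$ the operator norm induced by $\|\cdot\|$. $f$ is $\mu$-strongly star-convex with respect to a minimizer $x^*$ of $f$ if for all $x\in\mathbb{E}$ and $\alpha\in[0,1]$: $f(\alpha x+(1-\alpha)x^* )\le \alpha f(x)+(1-\alpha)f(x^* )-\frac{\alpha(1-\alpha)\mu}{2}\|x-x^*\|^2$. ($f$ need not be convex.) Cubic Regularized Newton Method with parameter $M_2$: $x_{t+1}=x_t+h_t$, where $h_t$ is a global minimizer over $h\in\mathbb{E}$ of $f(x_t)+\langle\nabla f(x_t),h\rangle+\frac12\langle\nabla^2 f(x_t)h,h\rangle+\frac{M_2}{6}\|h\|^3$. A method has a global superlinear convergence rate (in functional gap) if there is a sequence $\zeta_t$ with $\frac{f(x_{t+1})-f^*}{f(x_t)-f^*}\le\zeta_t$, $1>\zeta_t>\zeta_{t+1}$ for all $t$, and $\zeta_t\to0$ as $t\to\infty$; the ratio inequality is understood as $f(x_{t+1})-f^*\le\zeta_t(f(x_t)-f^* )$. *)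

theory Defs
  imports "HOL-Analysis.Analysis"
begin

text \<open>The space \<open>\<E>\<close> is a type \<open>'a :: euclidean_space\<close>, and its dual \<open>\<E>*\<close> is \<open>'a \<Rightarrow>\<^sub>L real\<close>;
  the pairing \<open>\<langle>s, h\<rangle>\<close> is application \<open>s h\<close>.  The inner product and norm of the class only
  provide the topology of the finite-dimensional space, on which differentiability depends.
  All metric notions refer to the norm induced by the operator \<open>B\<close>.\<close>

definition self_adjoint_pos_def ::
    "('a::euclidean_space \<Rightarrow>\<^sub>L ('a \<Rightarrow>\<^sub>L real)) \<Rightarrow> bool" where
  "self_adjoint_pos_def B \<longleftrightarrow>
     (\<forall>x y. B x y = B y x) \<and> (\<forall>x. x \<noteq> 0 \<longrightarrow> B x x > 0)"

definition Bnorm :: "('a::euclidean_space \<Rightarrow>\<^sub>L ('a \<Rightarrow>\<^sub>L real)) \<Rightarrow> 'a \<Rightarrow> real" where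
  "Bnorm B x = sqrt (B x x)"

definition dual_Bnorm ::
    "('a::euclidean_space \<Rightarrow>\<^sub>L ('a \<Rightarrow>\<^sub>L real)) \<Rightarrow> ('a \<Rightarrow>\<^sub>L real) \<Rightarrow> real" where
  "dual_Bnorm B s = (SUP h\<in>{h. Bnorm B h \<le> 1}. s h)"

text \<open>The norm of operators \<open>\<E> \<rightarrow> \<E>*\<close> induced by \<^term>\<open>Bnorm B\<close> on \<open>\<E>\<close> and its dual norm
  on \<open>\<E>*\<close>.  For positive definite \<open>B\<close> both suprema are over bounded nonempty sets.\<close>

definition op_Bnorm ::
    "('a::euclidean_space \<Rightarrow>\<^sub>L ('a \<Rightarrow>\<^sub>L real)) \<Rightarrow> ('a \<Rightarrow>\<^sub>L ('a \<Rightarrow>\<^sub>L real)) \<Rightarrow> real" where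
  "op_Bnorm B A = (SUP h\<in>{h. Bnorm B h \<le> 1}. dual_Bnorm B (A h))"

definition gradient :: "('a::euclidean_space \<Rightarrow> real) \<Rightarrow> 'a \<Rightarrow> ('a \<Rightarrow>\<^sub>L real)" where
  "gradient f x = Blinfun (frechet_derivative f (at x))"

definition hessian :: "('a::euclidean_space \<Rightarrow> real) \<Rightarrow> 'a \<Rightarrow> ('a \<Rightarrow>\<^sub>L ('a \<Rightarrow>\<^sub>L real))" where
  "hessian f x = Blinfun (frechet_derivative (gradient f) (at x))"

definition twice_continuously_differentiable :: "('a::euclidean_space \<Rightarrow> real) \<Rightarrow> bool" where
  "twice_continuously_differentiable f \<longleftrightarrow>
     (\<forall>x. f differentiable (at x)) \<and> (\<forall>x. gradient f differentiable (at x)) \<and>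
     continuous_on UNIV (hessian f)"

definition Lipschitz_hessian ::
    "('a::euclidean_space \<Rightarrow>\<^sub>L ('a \<Rightarrow>\<^sub>L real)) \<Rightarrow> real \<Rightarrow> ('a \<Rightarrow> real) \<Rightarrow> bool" where
  "Lipschitz_hessian B L f \<longleftrightarrow> twice_continuously_differentiable f \<and>
     (\<forall>x y. op_Bnorm B (hessian f x - hessian f y) \<le> L * Bnorm B (x - y))"

definition global_minimizer :: "('a \<Rightarrow> real) \<Rightarrow> 'a \<Rightarrow> bool" where
  "global_minimizer g z \<longleftrightarrow> is_arg_min g (\<lambda>_. True) z"

definition strongly_star_convex ::
    "('a::euclidean_space \<Rightarrow>\<^sub>L ('a \<Rightarrow>\<^sub>L real)) \<Rightarrow> real \<Rightarrow> ('a \<Rightarrow> real) \<Rightarrow> 'a \<Rightarrow> bool" where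
  "strongly_star_convex B \<mu> f xs \<longleftrightarrow> global_minimizer f xs \<and>
     (\<forall>x. \<forall>\<alpha>\<in>{0..1}. f (\<alpha> *\<^sub>R x + (1 - \<alpha>) *\<^sub>R xs)
        \<le> \<alpha> * f x + (1 - \<alpha>) * f xs - \<alpha> * (1 - \<alpha>) * \<mu> / 2 * (Bnorm B (x - xs))\<^sup>2)"

definition cubic_model ::
    "('a::euclidean_space \<Rightarrow>\<^sub>L ('a \<Rightarrow>\<^sub>L real)) \<Rightarrow> real \<Rightarrow> ('a \<Rightarrow> real) \<Rightarrow> 'a \<Rightarrow> 'a \<Rightarrow> real" where
  "cubic_model B M f x h =
     f x + gradient f x h + 1/2 * hessian f x h h + M / 6 * Bnorm B h ^ 3"

definition cubic_newton_sequence ::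
    "('a::euclidean_space \<Rightarrow>\<^sub>L ('a \<Rightarrow>\<^sub>L real)) \<Rightarrow> real \<Rightarrow> ('a \<Rightarrow> real) \<Rightarrow> (nat \<Rightarrow> 'a) \<Rightarrow> bool" where
  "cubic_newton_sequence B M f x \<longleftrightarrow>
     (\<forall>t. \<exists>h. global_minimizer (cubic_model B M f (x t)) h \<and> x (Suc t) = x t + h)"

definition superlinear_rate ::
    "('a \<Rightarrow> real) \<Rightarrow> real \<Rightarrow> (nat \<Rightarrow> 'a) \<Rightarrow> (nat \<Rightarrow> real) \<Rightarrow> bool" where
  "superlinear_rate f fstar x \<zeta> \<longleftrightarrow>
     (\<forall>t. f (x (Suc t)) - fstar \<le> \<zeta> t * (f (x t) - fstar)) \<and>
     (\<forall>t. 1 > \<zeta> t \<and> \<zeta> t > \<zeta> (Suc t)) \<and> \<zeta> \<longlonglongrightarrow> 0"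

end

theory Submission
  imports Defs
begin

text \<open>Write \<open>F t = f (x t) - f*\<close> and \<open>r t = \<parallel>x t - x*\<parallel>\<close>.  The Lipschitz Hessian gives
  \<open>f (x (t + 1)) \<le> f (x t + k) + (M2 + L2) / 6 * \<parallel>k\<parallel>^3\<close> for every \<open>k\<close>.  Taking
  \<open>k = a (x* - x t)\<close> and using strong star-convexity, \<open>F (t + 1) \<le> (1 - a) F t\<close> as soon as
  \<open>q a^2 \<le> 1 - a\<close> for some \<open>q \<ge> (M2 + L2) r t / (3 \<mu>)\<close>.  With \<open>r t \<le> D\<close> the choice
  \<open>a = \<alpha>low\<close> is admissible and yields linear convergence.  Combined with the quadratic growth
  \<open>\<mu> / 2 * (r t)^2 \<le> F t\<close>, this shows \<open>(M2 + L2) r t / (3 \<mu>) \<le> \<kappa> t\<close>, and \<open>a = \<alpha> t\<close> is exactly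
  the positive root of \<open>\<kappa> t * a^2 = 1 - a\<close>.\<close>

section \<open>The norm induced by \<open>B\<close> and its operator norm\<close>

lemma Bnorm_zero [simp]: "Bnorm B 0 = 0"
  by (simp add: Bnorm_def)

lemma Bnorm_nonneg: "self_adjoint_pos_def B \<Longrightarrow> 0 \<le> Bnorm B h"
  unfolding Bnorm_def self_adjoint_pos_def_def
  by (cases "h = 0") (auto intro: less_imp_le)

lemma Bnorm_pos: "self_adjoint_pos_def B \<Longrightarrow> h \<noteq> 0 \<Longrightarrow> 0 < Bnorm B h"
  by (simp add: Bnorm_def self_adjoint_pos_def_def)

lemma Bnorm_scaleR: "Bnorm B (c *\<^sub>R h) = \<bar>c\<bar> * Bnorm B h"
proof -
  have "B (c *\<^sub>R h) (c *\<^sub>R h) = c\<^sup>2 * B h h"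
    by (simp add: blinfun.scaleR_left blinfun.scaleR_right power2_eq_square)
  then show ?thesis
    by (simp add: Bnorm_def real_sqrt_mult)
qed

lemma continuous_on_Bnorm [continuous_intros]:
  "continuous_on S g \<Longrightarrow> continuous_on S (\<lambda>y. Bnorm B (g y))"
  unfolding Bnorm_def by (intro continuous_intros)

text \<open>On the compact unit sphere \<open>Bnorm B\<close> attains a positive minimum, and
  homogeneity carries the bound to every vector. It transfers boundedness from
  \<open>Bnorm B\<close> to the norm of the type class.\<close>

lemma norm_le_Bnorm:
  fixes B :: "'a::euclidean_space \<Rightarrow>\<^sub>L ('a \<Rightarrow>\<^sub>L real)"
  assumes "self_adjoint_pos_def B"
  obtains C where "C > 0" and "\<And>h. norm h \<le> C * Bnorm B h"
proof -
  obtain b :: 'a where b: "b \<in> Basis"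
    using nonempty_Basis by blast
  have "compact (sphere (0::'a) 1)" "sphere (0::'a) 1 \<noteq> {}"
    using b by auto
  then obtain u where u: "u \<in> sphere 0 1"
    and least: "\<And>y. y \<in> sphere 0 1 \<Longrightarrow> Bnorm B u \<le> Bnorm B y"
    using continuous_attains_inf[of "sphere 0 1" "Bnorm B"] continuous_on_Bnorm[OF continuous_on_id]
    by blast
  have pos: "0 < Bnorm B u"
    using u by (intro Bnorm_pos[OF assms]) auto
  have "norm h \<le> 1 / Bnorm B u * Bnorm B h" for h
  proof (cases "h = 0")
    case False
    then have "Bnorm B u \<le> Bnorm B ((1 / norm h) *\<^sub>R h)"
      by (intro least) simp
    then show ?thesis
      using False pos by (simp add: Bnorm_scaleR field_simps)
  qed simp
  then show thesis
    using that[of "1 / Bnorm B u"] pos by simp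
qed

text \<open>A real \<open>SUP\<close> bounds its members only when the set is bounded above, so both
  suprema are first bounded through \<open>C\<close>. Then \<open>h\<close> is normalized to
  \<open>u\<close>, and \<open>A u u\<close> passes under the dual norm and then under the operator
  norm.\<close>

lemma quadratic_form_le_op_Bnorm:
  fixes A :: "'a::euclidean_space \<Rightarrow>\<^sub>L ('a \<Rightarrow>\<^sub>L real)"
  assumes "self_adjoint_pos_def B"
  shows "A h h \<le> op_Bnorm B A * (Bnorm B h)\<^sup>2"
proof (cases "h = 0")
  case False
  obtain C where C: "C > 0" "\<And>h. norm h \<le> C * Bnorm B h"
    using norm_le_Bnorm[OF assms] by blast
  let ?U = "{h. Bnorm B h \<le> 1}"
  have normU: "norm v \<le> C" if "v \<in> ?U" for v
  proof -
    have "C * Bnorm B v \<le> C * 1"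
      using that C(1) by (intro mult_left_mono) auto
    with C(2)[of v] show ?thesis by simp
  qed
  have appU: "s v \<le> norm s * C" if "v \<in> ?U" for v and s :: "'a \<Rightarrow>\<^sub>L real"
  proof -
    have "s v \<le> norm s * norm v"
      using norm_blinfun[of s v] by simp
    also have "\<dots> \<le> norm s * C"
      using normU[OF that] by (intro mult_left_mono) auto
    finally show ?thesis .
  qed
  have bdd: "bdd_above (blinfun_apply s ` ?U)" for s :: "'a \<Rightarrow>\<^sub>L real"
    using appU by (intro bdd_aboveI2) blast
  have "0 \<in> ?U" by simp
  then have ne: "?U \<noteq> {}" by blast
  have dual: "dual_Bnorm B (A v) \<le> norm A * C * C" if "v \<in> ?U" for v
  proof -
    have "dual_Bnorm B (A v) \<le> norm (A v) * C"
      unfolding dual_Bnorm_def using ne appU by (intro cSUP_least) auto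
    also have "\<dots> \<le> (norm A * norm v) * C"
      using C(1) norm_blinfun[of A v] by (intro mult_right_mono) auto
    also have "\<dots> \<le> (norm A * C) * C"
      using C(1) normU[OF that] by (intro mult_right_mono mult_left_mono) auto
    finally show ?thesis .
  qed
  have bdd_dual: "bdd_above ((\<lambda>v. dual_Bnorm B (A v)) ` ?U)"
    using dual by (intro bdd_aboveI2) blast
  define n where "n = Bnorm B h"
  have n: "n > 0"
    using Bnorm_pos[OF assms False] by (simp add: n_def)
  define u where "u = (1 / n) *\<^sub>R h"
  have u: "u \<in> ?U"
    using n by (simp add: u_def Bnorm_scaleR n_def)
  have "A u u \<le> dual_Bnorm B (A u)"
    unfolding dual_Bnorm_def using cSUP_upper[OF u bdd] by simp
  also have "\<dots> \<le> op_Bnorm B A"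
    unfolding op_Bnorm_def using cSUP_upper[OF u bdd_dual] by simp
  finally have "A u u \<le> op_Bnorm B A" .
  moreover have "A u u = A h h / n\<^sup>2"
    by (simp add: u_def blinfun.scaleR_left blinfun.scaleR_right power2_eq_square)
  ultimately show ?thesis
    using n by (simp add: n_def field_simps)
qed simp

section \<open>Derivatives and two-sided cubic Taylor bounds\<close>

lemma gradient_has_derivative:
  "f differentiable (at x) \<Longrightarrow> (f has_derivative gradient f x) (at x)"
  unfolding gradient_def
  by (metis bounded_linear_Blinfun_apply frechet_derivative_works has_derivative_bounded_linear)

lemma hessian_has_derivative:
  "gradient f differentiable (at x) \<Longrightarrow> (gradient f has_derivative hessian f x) (at x)"
  unfolding hessian_def
  by (metis bounded_linear_Blinfun_apply frechet_derivative_works has_derivative_bounded_linear)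

text \<open>Integration is replaced by monotonicity: \<open>p\<close> is the cubic polynomial minus
  \<open>g\<close>, and \<open>p1\<close> is its derivative. The hypothesis on \<open>g2\<close>
  makes \<open>p1\<close> nondecreasing from \<open>p1 0 = 0\<close> on the half-line, hence
  \<open>p\<close> nondecreasing from \<open>p 0 = - g 0\<close>.\<close>

lemma taylor_cubic_le:
  fixes g g1 g2 :: "real \<Rightarrow> real"
  assumes g: "\<And>s. (g has_real_derivative g1 s) (at s)"
    and g1: "\<And>s. (g1 has_real_derivative g2 s) (at s)"
    and le: "\<And>s. 0 \<le> s \<Longrightarrow> g2 s \<le> g2 0 + c * s"
  shows "g 1 \<le> g 0 + g1 0 + g2 0 / 2 + c / 6"
proof -
  define p1 where "p1 s = g1 0 + g2 0 * s + c * s\<^sup>2 / 2 - g1 s" for s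
  define p where "p s = g1 0 * s + g2 0 * s\<^sup>2 / 2 + c * s ^ 3 / 6 - g s" for s
  have p1: "(p1 has_real_derivative g2 0 + c * s - g2 s) (at s)" for s
    unfolding p1_def by (rule derivative_eq_intros g1 refl | simp)+
  have p: "(p has_real_derivative p1 s) (at s)" for s
    unfolding p_def p1_def by (rule derivative_eq_intros g refl | simp)+
  have "p1 0 \<le> p1 s" if "0 \<le> s" for s
    using that
  proof (rule DERIV_nonneg_imp_nondecreasing)
    fix v :: real assume "0 \<le> v"
    then show "\<exists>y. (p1 has_real_derivative y) (at v) \<and> 0 \<le> y"
      using p1[of v] le[of v] by (intro exI[of _ "g2 0 + c * v - g2 v"]) simp
  qed
  then have "0 \<le> p1 s" if "0 \<le> s" for s
    using that by (simp add: p1_def)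
  then have "p 0 \<le> p 1"
    using p by (intro DERIV_nonneg_imp_nondecreasing[of 0 1 p]) auto
  then show ?thesis
    by (simp add: p_def)
qed

text \<open>Restricted to the line \<open>x + s *\<^sub>R h\<close>, the function meets the
  one-dimensional Taylor bound. With parameter \<open>- L\<close> the model has its cubic term
  subtracted, so the lower bound is the same estimate for the negated function.\<close>

lemma
  assumes B: "self_adjoint_pos_def B" and f: "Lipschitz_hessian B L f"
  shows Lipschitz_hessian_upper_model: "f (x + h) \<le> cubic_model B L f x h"
    and Lipschitz_hessian_lower_model: "cubic_model B (- L) f x h \<le> f (x + h)"
proof -
  define g1 where "g1 s = gradient f (x + s *\<^sub>R h) h" for s
  define g2 where "g2 s = hessian f (x + s *\<^sub>R h) h h" for s
  define g where "g s = f (x + s *\<^sub>R h)" for s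
  have df: "(f has_derivative gradient f y) (at y)"
    and dg: "(gradient f has_derivative hessian f y) (at y)" for y
    using f gradient_has_derivative hessian_has_derivative
    unfolding Lipschitz_hessian_def twice_continuously_differentiable_def by blast+
  have line: "((\<lambda>s. x + s *\<^sub>R h) has_derivative (\<lambda>s. s *\<^sub>R h)) (at s)" for s
    by (auto intro!: derivative_eq_intros)
  have g: "(g has_real_derivative g1 s) (at s)" for s
    using has_derivative_compose[OF line df, of s]
    by (simp add: g_def[abs_def] g1_def has_field_derivative_def blinfun.scaleR_right mult_commute_abs)
  have g1: "(g1 has_real_derivative g2 s) (at s)" for s
  proof -
    have "((\<lambda>s. gradient f (x + s *\<^sub>R h)) has_derivative (\<lambda>r. hessian f (x + s *\<^sub>R h) (r *\<^sub>R h))) (at s)"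
      using has_derivative_compose[OF line dg, of s] .
    then have "((\<lambda>s. gradient f (x + s *\<^sub>R h) h) has_derivative
        (\<lambda>r. hessian f (x + s *\<^sub>R h) (r *\<^sub>R h) h)) (at s)"
      by (rule bounded_linear.has_derivative[OF blinfun.bounded_linear_left])
    then show ?thesis
      by (simp add: g1_def[abs_def] g2_def has_field_derivative_def blinfun.scaleR_right blinfun.scaleR_left mult_commute_abs)
  qed
  \<comment> \<open>One factor of the norm comes from the displacement \<open>s *\<^sub>R h\<close>,
    two from the quadratic form in \<open>h\<close>.\<close>
  define c where "c = L * Bnorm B h ^ 3"
  have lip: "(hessian f y - hessian f z) h h \<le> L * Bnorm B (y - z) * (Bnorm B h)\<^sup>2" for y z
  proof -
    have "(hessian f y - hessian f z) h h \<le> op_Bnorm B (hessian f y - hessian f z) * (Bnorm B h)\<^sup>2"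
      by (rule quadratic_form_le_op_Bnorm[OF B])
    also have "\<dots> \<le> L * Bnorm B (y - z) * (Bnorm B h)\<^sup>2"
      using f by (intro mult_right_mono) (auto simp: Lipschitz_hessian_def)
    finally show ?thesis .
  qed
  have "g2 s \<le> g2 0 + c * s" if "0 \<le> s" for s
    using lip[of "x + s *\<^sub>R h" x] that
    by (simp add: g2_def c_def Bnorm_scaleR blinfun.diff_left power2_eq_square power3_eq_cube mult_ac)
  from taylor_cubic_le[OF g g1 this]
  show "f (x + h) \<le> cubic_model B L f x h"
    by (simp add: g_def g1_def g2_def c_def cubic_model_def)
  have "- g2 s \<le> - g2 0 + c * s" if "0 \<le> s" for s
    using lip[of x "x + s *\<^sub>R h"] that Bnorm_scaleR[of B "- s" h]
    by (simp add: g2_def c_def blinfun.diff_left power2_eq_square power3_eq_cube mult_ac)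
  from taylor_cubic_le[of "\<lambda>s. - g s" "\<lambda>s. - g1 s" "\<lambda>s. - g2 s" c, OF DERIV_minus[OF g] DERIV_minus[OF g1] this]
  show "cubic_model B (- L) f x h \<le> f (x + h)"
    by (simp add: g_def g1_def g2_def c_def cubic_model_def)
qed

section \<open>Decrease in one cubic Newton step under star-convexity\<close>

text \<open>The upper model at the actual step is raised from \<open>L\<close> to \<open>M\<close>,
  compared with \<open>k\<close> by minimality, then traded for the lower model at \<open>k\<close>.
  The models with parameters \<open>M\<close> and \<open>- L\<close> differ by exactly the cubic
  term in the bound.\<close>

lemma cubic_newton_step_le:
  assumes B: "self_adjoint_pos_def B" and f: "Lipschitz_hessian B L f" and "L \<le> M"
    and x: "cubic_newton_sequence B M f x"
  shows "f (x (Suc t)) \<le> f (x t + k) + (M + L) / 6 * Bnorm B k ^ 3"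
proof -
  obtain h where h: "global_minimizer (cubic_model B M f (x t)) h" "x (Suc t) = x t + h"
    using x unfolding cubic_newton_sequence_def by blast
  have "f (x (Suc t)) \<le> cubic_model B L f (x t) h"
    using h(2) Lipschitz_hessian_upper_model[OF B f] by simp
  also have "\<dots> \<le> cubic_model B M f (x t) h"
    using \<open>L \<le> M\<close> Bnorm_nonneg[OF B, of h]
    by (simp add: cubic_model_def mult_right_mono)
  also have "\<dots> \<le> cubic_model B M f (x t) k"
    using h(1) by (auto simp: global_minimizer_def is_arg_min_linorder)
  also have "\<dots> = cubic_model B (- L) f (x t) k + (M + L) / 6 * Bnorm B k ^ 3"
    by (simp add: cubic_model_def field_simps)
  also have "\<dots> \<le> f (x t + k) + (M + L) / 6 * Bnorm B k ^ 3"
    using Lipschitz_hessian_lower_model[OF B f] by simp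
  finally show ?thesis .
qed

lemma strongly_star_convex_minimizer:
  "strongly_star_convex B \<mu> f xs \<Longrightarrow> f xs \<le> f y"
  by (auto simp: strongly_star_convex_def global_minimizer_def is_arg_min_linorder)

lemma strongly_star_convexD:
  assumes "strongly_star_convex B \<mu> f xs" "0 \<le> a" "a \<le> 1"
  shows "f (a *\<^sub>R y + (1 - a) *\<^sub>R xs)
    \<le> a * f y + (1 - a) * f xs - a * (1 - a) * \<mu> / 2 * (Bnorm B (y - xs))\<^sup>2"
  using assms by (simp add: strongly_star_convex_def)

text \<open>Minimality of \<open>xs\<close> bounds the left side of star-convexity from below by
  \<open>f xs\<close>; dividing by \<open>a\<close> and letting \<open>a\<close> tend to 0 from the
  right removes the factor \<open>1 - a\<close>.\<close>

lemma strongly_star_convex_quadratic_growth: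
  assumes "strongly_star_convex B \<mu> f xs"
  shows "\<mu> / 2 * (Bnorm B (y - xs))\<^sup>2 \<le> f y - f xs"
proof -
  have "(1 - a) * (\<mu> / 2 * (Bnorm B (y - xs))\<^sup>2) \<le> f y - f xs" if "0 < a" "a < 1" for a
  proof -
    have "a * ((1 - a) * (\<mu> / 2 * (Bnorm B (y - xs))\<^sup>2)) \<le> a * (f y - f xs)"
      using strongly_star_convexD[OF assms, of a y] that
        strongly_star_convex_minimizer[OF assms, of "a *\<^sub>R y + (1 - a) *\<^sub>R xs"]
      by (simp add: algebra_simps)
    then show ?thesis
      using that by simp
  qed
  moreover have "\<forall>\<^sub>F a in at_right 0. 0 < a \<and> a < (1::real)"
    using eventually_at_right_real[of 0 1] by simp
  ultimately have "\<forall>\<^sub>F a in at_right 0. (1 - a) * (\<mu> / 2 * (Bnorm B (y - xs))\<^sup>2) \<le> f y - f xs"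
    by (auto elim!: eventually_mono)
  moreover have "((\<lambda>a. (1 - a) * (\<mu> / 2 * (Bnorm B (y - xs))\<^sup>2)) \<longlongrightarrow>
      (1 - 0) * (\<mu> / 2 * (Bnorm B (y - xs))\<^sup>2)) (at_right 0)"
    by (intro tendsto_intros)
  ultimately show ?thesis
    using tendsto_upperbound[of _ _ "at_right (0::real)"] by fastforce
qed

text \<open>The trial step goes the fraction \<open>a\<close> of the way to \<open>xs\<close>.
  Leaving \<open>q\<close> free allows one condition on \<open>a\<close> to serve both the bound by
  \<open>D\<close> and the bound by \<kappa>.\<close>

lemma cubic_newton_contraction:
  assumes B: "self_adjoint_pos_def B" and f: "Lipschitz_hessian B L f" and "L \<le> M"
    and x: "cubic_newton_sequence B M f x"
    and star: "strongly_star_convex B \<mu> f xs"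
    and a: "0 \<le> a" "a \<le> 1" and "0 < \<mu>"
    and q: "(M + L) * Bnorm B (x t - xs) / (3 * \<mu>) \<le> q" "q * a\<^sup>2 \<le> 1 - a"
  shows "f (x (Suc t)) - f xs \<le> (1 - a) * (f (x t) - f xs)"
proof -
  define r where "r = Bnorm B (x t - xs)"
  have "Bnorm B (a *\<^sub>R (xs - x t)) = a * r"
    using Bnorm_scaleR[of B "- a" "x t - xs"] a by (simp add: r_def algebra_simps)
  moreover have "x t + a *\<^sub>R (xs - x t) = (1 - a) *\<^sub>R x t + (1 - (1 - a)) *\<^sub>R xs"
    by (simp add: algebra_simps)
  ultimately have "f (x (Suc t)) \<le> f ((1 - a) *\<^sub>R x t + (1 - (1 - a)) *\<^sub>R xs) + (M + L) / 6 * (a * r) ^ 3"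
    using cubic_newton_step_le[OF B f \<open>L \<le> M\<close> x, of t "a *\<^sub>R (xs - x t)"] by simp
  also have "\<dots> \<le> (1 - a) * f (x t) + (1 - (1 - a)) * f xs
      - (1 - a) * (1 - (1 - a)) * \<mu> / 2 * r\<^sup>2 + (M + L) / 6 * (a * r) ^ 3"
    using strongly_star_convexD[OF star, of "1 - a" "x t"] a by (simp add: r_def)
  \<comment> \<open>The strong star-convexity gain and the cubic error share the factor
    \<open>a * r\<^sup>2 / 2\<close>; the hypotheses on \<open>q\<close> make the remaining bracket
    nonnegative.\<close>
  finally have main: "f (x (Suc t)) - f xs \<le> (1 - a) * (f (x t) - f xs)
      - a * r\<^sup>2 / 2 * (\<mu> * (1 - a) - (M + L) * r / 3 * a\<^sup>2)"
    by (simp add: field_simps power2_eq_square power3_eq_cube)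
  have "(M + L) * r / (3 * \<mu>) * a\<^sup>2 \<le> q * a\<^sup>2"
    using q(1) by (intro mult_right_mono) (auto simp: r_def)
  then have "(M + L) * r / (3 * \<mu>) * a\<^sup>2 \<le> 1 - a"
    using q(2) by simp
  then have "0 \<le> \<mu> * (1 - a) - (M + L) * r / 3 * a\<^sup>2"
    using \<open>0 < \<mu>\<close> by (simp add: field_simps)
  then have "0 \<le> a * r\<^sup>2 / 2 * (\<mu> * (1 - a) - (M + L) * r / 3 * a\<^sup>2)"
    using a by simp
  with main show ?thesis by linarith
qed

section \<open>The radius of the sublevel set\<close>

text \<open>\<open>GREATEST\<close> is informative only if a maximum exists. Continuity makes the
  sublevel set closed and quadratic growth makes it bounded, so compactness supplies the
  maximum.\<close>

lemma sublevel_radius_attained: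
  assumes B: "self_adjoint_pos_def B" and f: "Lipschitz_hessian B L f"
    and star: "strongly_star_convex B \<mu> f xs" and "0 < \<mu>"
    and D: "D = (GREATEST r. r \<in> {Bnorm B (y - xs) | y. f y \<le> c})"
    and y: "f y \<le> c"
  shows "Bnorm B (y - xs) \<le> D"
proof -
  let ?S = "{y. f y \<le> c}"
  obtain C where C: "C > 0" "\<And>h. norm h \<le> C * Bnorm B h"
    using norm_le_Bnorm[OF B] by blast
  have cont: "continuous_on UNIV f"
    using f unfolding Lipschitz_hessian_def twice_continuously_differentiable_def
    by (simp add: continuous_at_imp_continuous_on differentiable_imp_continuous_within)
  have "closed ?S"
    using cont by (intro closed_Collect_le continuous_intros)
  moreover have "norm (z - xs) \<le> C * sqrt (2 * (c - f xs) / \<mu>)" if "z \<in> ?S" for z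
  proof -
    have "\<mu> / 2 * (Bnorm B (z - xs))\<^sup>2 \<le> c - f xs"
      using strongly_star_convex_quadratic_growth[OF star, of z] that by simp
    then have "(Bnorm B (z - xs))\<^sup>2 \<le> 2 * (c - f xs) / \<mu>"
      using \<open>0 < \<mu>\<close> by (simp add: field_simps)
    then have "Bnorm B (z - xs) \<le> sqrt (2 * (c - f xs) / \<mu>)"
      by (rule real_le_rsqrt)
    then have "C * Bnorm B (z - xs) \<le> C * sqrt (2 * (c - f xs) / \<mu>)"
      using C(1) by (intro mult_left_mono) auto
    then show ?thesis
      using C(2)[of "z - xs"] by linarith
  qed
  then have "?S \<subseteq> cball xs (C * sqrt (2 * (c - f xs) / \<mu>))"
    by (auto simp: dist_norm norm_minus_commute)
  then have "bounded ?S"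
    using bounded_subset bounded_cball by blast
  ultimately have "compact ?S"
    by (simp add: compact_eq_bounded_closed)
  moreover have "continuous_on ?S (\<lambda>z. Bnorm B (z - xs))"
    by (intro continuous_intros)
  ultimately obtain z where "z \<in> ?S" and max: "\<And>w. w \<in> ?S \<Longrightarrow> Bnorm B (w - xs) \<le> Bnorm B (z - xs)"
    using continuous_attains_sup[of ?S "\<lambda>z. Bnorm B (z - xs)"] y by blast
  then have "D = Bnorm B (z - xs)"
    unfolding D by (intro Greatest_equality) auto
  then show ?thesis
    using max y by simp
qed

section \<open>The positive root of \<open>k * a\<^sup>2 = 1 - a\<close>\<close>

text \<open>Multiplying by the conjugate gives a form that is visibly decreasing in \<open>k\<close>
  and continuous at \<open>k = 0\<close>, where the original reads 0/0.\<close>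

lemma positive_root_rationalized:
  fixes k :: real
  assumes "0 < k"
  shows "(-1 + sqrt (1 + 4 * k)) / (2 * k) = 2 / (1 + sqrt (1 + 4 * k))"
proof -
  have "(-1 + sqrt (1 + 4 * k)) * (1 + sqrt (1 + 4 * k)) = 2 * (2 * k)"
    using assms by (simp add: algebra_simps)
  moreover have "1 + sqrt (1 + 4 * k) > 0"
    using assms by (intro add_pos_pos) auto
  ultimately show ?thesis
    using assms by (simp add: frac_eq_eq)
qed

text \<open>With \<open>s = sqrt (1 + 4 * k)\<close> one has
  \<open>k = (s - 1) * (s + 1) / 4\<close>, and both sides equal
  \<open>(s - 1) / (s + 1)\<close>.\<close>

lemma positive_root_eq:
  fixes k :: real
  assumes "0 < k" and a: "a = 2 / (1 + sqrt (1 + 4 * k))"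
  shows "k * a\<^sup>2 = 1 - a"
proof -
  define s where "s = sqrt (1 + 4 * k)"
  have s: "1 < s" "s\<^sup>2 = 1 + 4 * k"
    using assms(1) by (auto simp: s_def)
  then have "k = (s\<^sup>2 - 1) / 4" "1 + s \<noteq> 0" by auto
  then show ?thesis
    unfolding a s_def[symmetric] by (simp add: divide_simps) (simp add: power2_eq_square algebra_simps)
qed

theorem theorem3p4:
  fixes B :: "'a::euclidean_space \<Rightarrow>\<^sub>L ('a \<Rightarrow>\<^sub>L real)"
    and f :: "'a \<Rightarrow> real"
    and xs x0 :: 'a
    and x :: "nat \<Rightarrow> 'a"
    and \<mu> L2 M2 fstar D \<alpha>low :: real
    and \<kappa> \<alpha> :: "nat \<Rightarrow> real"
  assumes "self_adjoint_pos_def B"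
    and "\<mu> > 0" and "L2 > 0" and "M2 \<ge> L2"
    and "strongly_star_convex B \<mu> f xs"
    and "Lipschitz_hessian B L2 f"
    and "f x0 > f xs"
    and "x 0 = x0" and "cubic_newton_sequence B M2 f x"
    and fstar_def: "fstar = f xs"
    and D_def: "D = (GREATEST r. r \<in> {Bnorm B (y - xs) | y. f y \<le> f x0})"
    and \<alpha>low_def: "\<alpha>low = min (1/2) (sqrt (3 * \<mu> / (4 * (M2 + L2) * D)))"
    and \<kappa>_def: "\<And>t. \<kappa> t = (M2 + L2) * sqrt 2 / (3 * \<mu> powr (3/2))
                        * (1 - \<alpha>low) powr (real t / 2) * (f x0 - fstar) powr (1/2)"
    and \<alpha>_def: "\<And>t. \<alpha> t = (-1 + sqrt (1 + 4 * \<kappa> t)) / (2 * \<kappa> t)"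
  shows "superlinear_rate f fstar x (\<lambda>t. 1 - \<alpha> t)
         \<and> (\<forall>T\<ge>1. f (x T) - fstar \<le> (f x0 - fstar) * (\<Prod>t=0..T-1. (1 - \<alpha> t)))"
proof -
  note B = assms(1) and star = assms(5) and f = assms(6)
  define F where "F t = f (x t) - fstar" for t
  define r where "r t = Bnorm B (x t - xs)" for t
  define q where "q t = (M2 + L2) * r t / (3 * \<mu>)" for t
  have M_pos: "0 < M2 + L2" and \<mu>: "0 < \<mu>" using assms(2-4) by auto
  have F0: "0 < F 0" "F 0 = f x0 - fstar" using assms(7,8) by (auto simp: F_def fstar_def)
  have growth: "\<mu> / 2 * (r t)\<^sup>2 \<le> F t" for t
    unfolding r_def F_def fstar_def by (rule strongly_star_convex_quadratic_growth[OF star])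
  have contraction: "F (Suc t) \<le> (1 - a) * F t"
    if "0 \<le> a" "a \<le> 1" "q t \<le> p" "p * a\<^sup>2 \<le> 1 - a" for a p t
    using cubic_newton_contraction[OF B f \<open>M2 \<ge> L2\<close> assms(9) star that(1,2) \<mu>, of t p] that(3,4)
    by (simp add: F_def fstar_def q_def r_def)
  have r_le_D: "r t \<le> D" if "F t \<le> F 0" for t
    unfolding r_def using that
    by (intro sublevel_radius_attained[OF B f star \<mu> D_def]) (simp add: F_def assms(8))
  \<comment> \<open>Positivity of \<open>D\<close> matters: with \<open>D = 0\<close>, division by
    zero would yield 0 and make \<open>\<alpha>low\<close> vanish.\<close>
  have "x0 \<noteq> xs" using assms(7) by auto
  then have "0 < D"
    using r_le_D[of 0] Bnorm_pos[OF B, of "x0 - xs"] by (simp add: r_def assms(8))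
  then have low: "0 < \<alpha>low" "\<alpha>low \<le> 1/2"
    using \<mu> M_pos by (auto simp: \<alpha>low_def)
  \<comment> \<open>The two arguments of \<open>min\<close> work together: the square root brings
    the left side of \<open>low_admissible\<close> down to 1/4, and the cap 1/2 keeps
    \<open>1 - \<alpha>low\<close> at least 1/2.\<close>
  have "\<alpha>low\<^sup>2 \<le> (sqrt (3 * \<mu> / (4 * (M2 + L2) * D)))\<^sup>2"
    using low by (intro power_mono) (auto simp: \<alpha>low_def)
  also have "\<dots> = 3 * \<mu> / (4 * (M2 + L2) * D)"
    using \<mu> M_pos \<open>0 < D\<close> by simp
  finally have "(M2 + L2) * D / (3 * \<mu>) * \<alpha>low\<^sup>2
      \<le> (M2 + L2) * D / (3 * \<mu>) * (3 * \<mu> / (4 * (M2 + L2) * D))"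
    using \<mu> M_pos \<open>0 < D\<close> by (intro mult_left_mono) auto
  also have "\<dots> = 1 / 4"
    using \<mu> M_pos \<open>0 < D\<close> by simp
  finally have low_admissible: "(M2 + L2) * D / (3 * \<mu>) * \<alpha>low\<^sup>2 \<le> 1 - \<alpha>low"
    using low by simp
  \<comment> \<open>The induction hypothesis also keeps the iterate in the initial sublevel set, so
    that \<open>D\<close> bounds its distance to \<open>xs\<close>.\<close>
  have linear: "F t \<le> (1 - \<alpha>low) ^ t * F 0" for t
  proof (induction t)
    case (Suc t)
    have "(1 - \<alpha>low) ^ t * F 0 \<le> 1 * F 0"
      using low F0 by (intro mult_right_mono power_le_one) auto
    then have "r t \<le> D"
      using r_le_D Suc.IH by simp
    then have "q t \<le> (M2 + L2) * D / (3 * \<mu>)"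
      unfolding q_def using \<mu> M_pos by (intro divide_right_mono mult_left_mono) auto
    then have "F (Suc t) \<le> (1 - \<alpha>low) * F t"
      using low low_admissible by (intro contraction) auto
    also have "\<dots> \<le> (1 - \<alpha>low) * ((1 - \<alpha>low) ^ t * F 0)"
      using low Suc.IH by (intro mult_left_mono) auto
    finally show ?case by simp
  qed simp
  \<comment> \<open>In these terms \<kappa> is the geometric sequence \<open>K * w ^ t\<close>, from
    which its strict decrease and limit 0 follow.\<close>
  define w where "w = sqrt (1 - \<alpha>low)"
  define K where "K = (M2 + L2) * sqrt 2 / (3 * (\<mu> * sqrt \<mu>)) * sqrt (F 0)"
  have w: "0 < w" "w < 1" using low by (auto simp: w_def)
  have K: "0 < K" using M_pos \<mu> F0 by (simp add: K_def)
  have \<kappa>_geometric: "\<kappa> t = K * w ^ t" for t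
  proof -
    have "\<mu> powr (3/2) = \<mu> powr 1 * \<mu> powr (1/2)"
      by (subst powr_add[symmetric]) simp
    then have "\<mu> powr (3/2) = \<mu> * sqrt \<mu>"
      using \<mu> by (simp add: powr_half_sqrt)
    moreover have "(1 - \<alpha>low) powr (real t / 2) = w ^ t"
    proof -
      have "(1 - \<alpha>low) powr (real t / 2) = ((1 - \<alpha>low) powr (1/2)) powr real t"
        by (simp add: powr_powr)
      also have "\<dots> = w ^ t"
        using low w by (simp add: powr_half_sqrt w_def powr_realpow)
      finally show ?thesis .
    qed
    moreover have "(f x0 - fstar) powr (1/2) = sqrt (F 0)"
      using F0 by (simp add: powr_half_sqrt)
    ultimately show ?thesis
      by (simp add: \<kappa>_def K_def)
  qed
  have \<kappa>_pos: "0 < \<kappa> t" for t using K w by (simp add: \<kappa>_geometric)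
  \<comment> \<open>Quadratic growth turns the linear rate of \<open>F\<close> into decay of the
    distance at the rate \<open>w\<close>; the constants then combine to \<open>K\<close>.\<close>
  have q_le: "q t \<le> \<kappa> t" for t
  proof -
    have "(r t)\<^sup>2 \<le> 2 * F t / \<mu>"
      using growth[of t] \<mu> by (simp add: field_simps)
    also have "\<dots> \<le> 2 * ((1 - \<alpha>low) ^ t * F 0) / \<mu>"
      using linear[of t] \<mu> by (intro divide_right_mono mult_left_mono) auto
    finally have "r t \<le> sqrt (2 * ((1 - \<alpha>low) ^ t * F 0) / \<mu>)"
      by (rule real_le_rsqrt)
    also have "\<dots> = sqrt 2 * (w ^ t * sqrt (F 0)) / sqrt \<mu>"
      by (simp add: real_sqrt_mult real_sqrt_divide real_sqrt_power w_def)
    finally have "q t \<le> (M2 + L2) * (sqrt 2 * (w ^ t * sqrt (F 0)) / sqrt \<mu>) / (3 * \<mu>)"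
      unfolding q_def using M_pos \<mu> by (intro divide_right_mono mult_left_mono) auto
    also have "\<dots> = \<kappa> t"
      by (simp add: \<kappa>_geometric K_def mult_ac)
    finally show ?thesis .
  qed
  have \<alpha>_eq: "\<alpha> t = 2 / (1 + sqrt (1 + 4 * \<kappa> t))" for t
    unfolding \<alpha>_def by (rule positive_root_rationalized[OF \<kappa>_pos])
  have sqrt_gt: "1 < sqrt (1 + 4 * \<kappa> t)" for t using \<kappa>_pos[of t] by simp
  have \<alpha>: "0 < \<alpha> t" "\<alpha> t < 1" for t
    unfolding \<alpha>_eq using sqrt_gt[of t]
    by (auto intro!: divide_pos_pos simp del: real_sqrt_gt_1_iff simp: divide_less_eq)
  \<comment> \<open>The contraction is used with \<open>p = \<kappa> t\<close>, where its condition
    on \<open>a\<close> holds with equality.\<close>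
  have step: "F (Suc t) \<le> (1 - \<alpha> t) * F t" for t
    using \<alpha>[of t] q_le[of t] positive_root_eq[OF \<kappa>_pos \<alpha>_eq, of t]
    by (intro contraction) auto
  have "\<alpha> t < \<alpha> (Suc t)" for t
  proof -
    have "\<kappa> (Suc t) < \<kappa> t" using K w by (simp add: \<kappa>_geometric)
    then have "sqrt (1 + 4 * \<kappa> (Suc t)) < sqrt (1 + 4 * \<kappa> t)" by simp
    then show ?thesis
      unfolding \<alpha>_eq using \<kappa>_pos[of t] \<kappa>_pos[of "Suc t"]
      by (intro divide_strict_left_mono mult_pos_pos add_pos_pos) auto
  qed
  moreover have "(\<lambda>t. 1 - \<alpha> t) \<longlonglongrightarrow> 0"
  proof -
    have "(\<lambda>t. 1 - 2 / (1 + sqrt (1 + 4 * (K * w ^ t))))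
        \<longlonglongrightarrow> 1 - 2 / (1 + sqrt (1 + 4 * (K * 0)))"
      using w by (intro tendsto_intros) auto
    then show ?thesis by (simp add: \<alpha>_eq \<kappa>_geometric)
  qed
  ultimately have "superlinear_rate f fstar x (\<lambda>t. 1 - \<alpha> t)"
    using step \<alpha> by (simp add: superlinear_rate_def F_def)
  moreover have prod: "F T \<le> F 0 * (\<Prod>t<T. 1 - \<alpha> t)" for T
  proof (induction T)
    case (Suc T)
    have "F (Suc T) \<le> (1 - \<alpha> T) * F T" by (rule step)
    also have "\<dots> \<le> (1 - \<alpha> T) * (F 0 * (\<Prod>t<T. 1 - \<alpha> t))"
      using Suc.IH \<alpha>[of T] by (intro mult_left_mono) auto
    finally show ?case by (simp add: mult_ac)
  qed simp
  have "f (x T) - fstar \<le> (f x0 - fstar) * (\<Prod>t=0..T-1. (1 - \<alpha> t))" if "T \<ge> 1" for T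
  proof -
    \<comment> \<open>Natural subtraction truncates, so for \<open>T = 0\<close> the left side would
      still contain 0; \<open>T \<ge> 1\<close> excludes this.\<close>
    have "{0..T-1} = {..<T}" using that by auto
    then show ?thesis using prod[of T] F0(2) by (simp add: F_def)
  qed
  ultimately show ?thesis by blast
qed

end
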